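(* Let $F=0$ be a structurally amenable DAE of size $n$ with signature matrix $\Sigma$, and let $(c,d)$ be a normalised, valid offset pair for $F$. Let $k=(k_1,\dots,k_n)$ be a multi-index of integers $k_r\ge0$, and let $F^*=\mathfrak{d}^{(k)}F$, with signature matrix $\Sigma^*$. Then: (i) $\Sigma^*$ and $\Sigma$ have the same set of highest-value transversals. (ii) $(c^*,d^* )=\mathfrak{d}^{(k)}(c,d)$ is a normalised, valid offset pair for $F^*$. (iii) $(c^*,d^* )$ gives the same Jacobian for $F^*$ as $(c,d)$ does for $F$: $\mathbf{J}(F^*;(c^*,d^* ))=\mathbf{J}(F;(c,d))$. (iv) $F^*=0$ is structurally amenable, with $\mathrm{dof}(F^* )=\mathrm{dof}(F)+|k|$, where $|k|=\sum_r k_r$. Adding $|k|$ suitable initial value conditions gives $F^*=0$ the same solution set as $F=0$.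
   Context: A DAE of size $n$ is a system $F_i(t,\text{the }x_j\text{ and derivatives of them})=0$, $i=1,\dots,n$, in unknown functions $x_j=x_j(t)$, $j=1,\dots,n$, written $F=0$. All functions are assumed suitably smooth. The 0th derivative of $x_j$ is $x_j$ itself. Differentiation with respect to $t$ is total differentiation: regarding $g$ as a function of $t$ and of selected $x_j^{(e)}$ as unrelated algebraic variables, $\dot g=\partial g/\partial t+\sum (\partial g/\partial x_j^{(e)})\,x_j^{(e+1)}$, the sum being over the $x_j^{(e)}$ occurring in $g$. Signature matrix: $\Sigma=(\sigma_{ij})$ is $n\times n$, with $\sigma_{ij}$ the highest order of derivative of $x_j$ occurring in $F_i$, or $-\infty$ if $x_j$ does not occur in $F_i$. A transversal is a set $\mathcal{T}$ of $n$ positions $(i,j)$ with exactly one in each row and each column; its value is $\sum_{(i,j)\in\mathcal{T}}\sigma_{ij}$. If some transversal has finite value, a highest-value transversal (HVT) is a transversal of largest value, and that value is $\mathrm{Val}(\Sigma)$. Offsets: a pair of integer vectors $c=(c_1,\dots,c_n)$, $d=(d_1,\dots,d_n)$. They are valid if $d_j-c_i\ge\sigma_{ij}$ for all $i,j$, with equality for all $(i,j)$ on some transversal; normalised if $\min_i c_i=0$. System Jacobian: for valid offsets, $\mathbf{J}(F;(c,d))$ is the $n\times n$ matrix with $(i,j)$ entry $\partial F_i/\partial x_j^{(\sigma_{ij})}$ if $d_j-c_i=\sigma_{ij}$, and $0$ otherwise. The DAE is structurally amenable if there are valid offsets for which the system Jacobian is nonsingular somewhere, i.e. at some consistent point of the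 DAE (a point lying on a solution path). In that case $\mathrm{dof}(F):=\mathrm{Val}(\Sigma)$, the number of degrees of freedom. $\mathfrak{d}^{(k)}F$ is the DAE obtained from $F$ by differentiating its $r$th function $F_r$ with respect to $t$ a total of $k_r$ times (replacing $F_r$ by $F_r^{(k_r)}$), for $r=1,\dots,n$. $\mathfrak{d}^{(k)}(c,d)$ is the offset pair obtained by first replacing $c$ by $c-k$, then forming $\gamma=\min_i c_i$ and replacing each $c_i$ by $c_i-\gamma$ and each $d_j$ by $d_j-\gamma$. An initial value condition here is a scalar condition imposed at a base point $t=t_0$; "same solution set" means that the solutions of $F^*=0$ satisfying the added conditions are exactly the solutions of $F=0$. *)

theory Defs
  imports "HOL-Analysis.Analysis"
begin

section \<open>Functions of t, the unknowns and their derivatives\<close>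

text \<open>
  The independent variables of a DAE function: the time t, and for each unknown
  \<open>x\<^sub>j\<close> and each \<open>e \<ge> 0\<close> the derivative of order \<open>e\<close> of \<open>x\<^sub>j\<close>, all regarded as
  unrelated algebraic variables.  A jet assigns a value to each of them; the
  space of jets carries the product topology.
\<close>

datatype 'n jvar = Tm | Der 'n nat

type_synonym 'n jet = "'n jvar \<Rightarrow> real"

definition partial :: "'n jvar \<Rightarrow> ('n jet \<Rightarrow> real) \<Rightarrow> 'n jet \<Rightarrow> real" where
  "partial v g p = deriv (\<lambda>s. g (p(v := s))) (p v)"

text \<open>
  Infinitely often differentiable on the open set \<open>U\<close>: all iterated partial derivatives
  exist and are continuous.
\<close>

definition smooth_fun :: "'n jet set \<Rightarrow> ('n jet \<Rightarrow> real) \<Rightarrow> bool" where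
  "smooth_fun U g \<longleftrightarrow>
     (\<forall>vs. continuous_on U (foldr partial vs g) \<and>
        (\<forall>v. \<forall>p\<in>U. (\<lambda>s. foldr partial vs g (p(v := s))) differentiable (at (p v))))"

text \<open>
  Although a jet has infinitely many components, both the domain \<open>U\<close> and the function
  only involve derivatives up to some finite order.
\<close>

definition finite_order :: "'n jet set \<Rightarrow> ('n jet \<Rightarrow> real) \<Rightarrow> bool" where
  "finite_order U g \<longleftrightarrow>
     (\<exists>m. \<forall>p q. p Tm = q Tm \<and> (\<forall>j. \<forall>e\<le>m. p (Der j e) = q (Der j e)) \<longrightarrow>
        (p \<in> U \<longleftrightarrow> q \<in> U) \<and> (p \<in> U \<longrightarrow> g p = g q))"

definition jet_fun :: "'n jet set \<Rightarrow> ('n jet \<Rightarrow> real) \<Rightarrow> bool" where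
  "jet_fun U g \<longleftrightarrow> open U \<and> finite_order U g \<and> smooth_fun U g"

text \<open>
  The variable \<open>v\<close> occurs in \<open>g\<close> if moving \<open>v\<close> alone, along a segment within the domain, can
  change the value of \<open>g\<close>.  (A purely locally constant dependence, possible only if the
  domain has disconnected slices, thus does not count.)
\<close>

definition occurs :: "'n jet set \<Rightarrow> ('n jet \<Rightarrow> real) \<Rightarrow> 'n jvar \<Rightarrow> bool" where
  "occurs U g v \<longleftrightarrow>
     (\<exists>p s. (\<forall>r\<in>closed_segment (p v) s. p(v := r) \<in> U) \<and> g (p(v := s)) \<noteq> g p)"

definition total_deriv :: "'n jet set \<Rightarrow> ('n jet \<Rightarrow> real) \<Rightarrow> 'n jet \<Rightarrow> real" where
  "total_deriv U g p = partial Tm g p +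
     (\<Sum>(j, e) \<in> {(j, e). occurs U g (Der j e)}. partial (Der j e) g p * p (Der j (Suc e)))"

section \<open>DAEs and their solutions\<close>

text \<open>
  A DAE of size \<open>n = CARD('n)\<close> is given by an open domain \<open>U\<close> and \<open>n\<close> functions \<open>F i\<close> on it;
  their values outside \<open>U\<close> are irrelevant.
\<close>

definition dae :: "'n::finite jet set \<Rightarrow> ('n \<Rightarrow> 'n jet \<Rightarrow> real) \<Rightarrow> bool" where
  "dae U F \<longleftrightarrow> (\<forall>i. jet_fun U (F i))"

definition jet_of :: "('n \<Rightarrow> real \<Rightarrow> real) \<Rightarrow> real \<Rightarrow> 'n jet" where
  "jet_of x t = (\<lambda>v. case v of Tm \<Rightarrow> t | Der j e \<Rightarrow> (deriv ^^ e) (x j) t)"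

text \<open>Smooth solutions; \<open>I\<close> is meant to be an open interval, possibly unbounded.\<close>

definition solution ::
  "'n::finite jet set \<Rightarrow> ('n \<Rightarrow> 'n jet \<Rightarrow> real) \<Rightarrow> real set \<Rightarrow> ('n \<Rightarrow> real \<Rightarrow> real) \<Rightarrow> bool" where
  "solution U F I x \<longleftrightarrow>
     (\<forall>t\<in>I. (\<forall>j e. (deriv ^^ e) (x j) differentiable (at t)) \<and>
        jet_of x t \<in> U \<and> (\<forall>i. F i (jet_of x t) = 0))"

definition consistent_point ::
  "'n::finite jet set \<Rightarrow> ('n \<Rightarrow> 'n jet \<Rightarrow> real) \<Rightarrow> 'n jet \<Rightarrow> bool" where
  "consistent_point U F p \<longleftrightarrow>
     (\<exists>I x t. open I \<and> is_interval I \<and> t \<in> I \<and> solution U F I x \<and> p = jet_of x t)"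

section \<open>Signature matrix, transversals, offsets\<close>

definition top_order :: "'n jet set \<Rightarrow> ('n jet \<Rightarrow> real) \<Rightarrow> 'n \<Rightarrow> nat" where
  "top_order U g j = Max {e. occurs U g (Der j e)}"

definition sig_matrix :: "'n::finite jet set \<Rightarrow> ('n \<Rightarrow> 'n jet \<Rightarrow> real) \<Rightarrow> 'n \<Rightarrow> 'n \<Rightarrow> ereal" where
  "sig_matrix U F i j =
     (if \<exists>e. occurs U (F i) (Der j e) then ereal (real (top_order U (F i) j)) else -\<infinity>)"

definition transversal :: "('n \<times> 'n) set \<Rightarrow> bool" where
  "transversal T \<longleftrightarrow> (\<forall>i. \<exists>!j. (i, j) \<in> T) \<and> (\<forall>j. \<exists>!i. (i, j) \<in> T)"

definition tvalue :: "('n \<Rightarrow> 'n \<Rightarrow> ereal) \<Rightarrow> ('n \<times> 'n) set \<Rightarrow> ereal" where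
  "tvalue S T = (\<Sum>(i, j)\<in>T. S i j)"

definition Val :: "('n::finite \<Rightarrow> 'n \<Rightarrow> ereal) \<Rightarrow> ereal" where
  "Val S = Max (tvalue S ` {T. transversal T})"

definition hvt :: "('n::finite \<Rightarrow> 'n \<Rightarrow> ereal) \<Rightarrow> ('n \<times> 'n) set \<Rightarrow> bool" where
  "hvt S T \<longleftrightarrow> transversal T \<and> tvalue S T \<noteq> -\<infinity> \<and> tvalue S T = Val S"

definition valid_offsets ::
  "('n::finite \<Rightarrow> 'n \<Rightarrow> ereal) \<Rightarrow> ('n \<Rightarrow> int) \<Rightarrow> ('n \<Rightarrow> int) \<Rightarrow> bool" where
  "valid_offsets S c d \<longleftrightarrow>
     (\<forall>i j. S i j \<le> ereal (of_int (d j - c i))) \<and>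
     (\<exists>T. transversal T \<and> (\<forall>(i, j)\<in>T. S i j = ereal (of_int (d j - c i))))"

definition normalised :: "('n::finite \<Rightarrow> int) \<Rightarrow> bool" where
  "normalised c \<longleftrightarrow> Min (range c) = 0"

definition system_jacobian ::
  "'n::finite jet set \<Rightarrow> ('n \<Rightarrow> 'n jet \<Rightarrow> real) \<Rightarrow> ('n \<Rightarrow> int) \<Rightarrow> ('n \<Rightarrow> int) \<Rightarrow> 'n jet \<Rightarrow> real^'n^'n"
where
  "system_jacobian U F c d p =
     (\<chi> i j. if sig_matrix U F i j = ereal (of_int (d j - c i))
             then partial (Der j (top_order U (F i) j)) (F i) p else 0)"

definition structurally_amenable ::
  "'n::finite jet set \<Rightarrow> ('n \<Rightarrow> 'n jet \<Rightarrow> real) \<Rightarrow> bool" where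
  "structurally_amenable U F \<longleftrightarrow> dae U F \<and>
     (\<exists>c d. valid_offsets (sig_matrix U F) c d \<and>
        (\<exists>p. consistent_point U F p \<and> invertible (system_jacobian U F c d p)))"

text \<open>
  Meaningful for structurally amenable DAEs only, for which the value is a (finite) integer.
\<close>

definition dof :: "'n::finite jet set \<Rightarrow> ('n \<Rightarrow> 'n jet \<Rightarrow> real) \<Rightarrow> ereal" where
  "dof U F = Val (sig_matrix U F)"

section \<open>Differentiating some of the functions\<close>

definition diff_dae ::
  "('n \<Rightarrow> nat) \<Rightarrow> 'n jet set \<Rightarrow> ('n \<Rightarrow> 'n jet \<Rightarrow> real) \<Rightarrow> 'n \<Rightarrow> 'n jet \<Rightarrow> real" where
  "diff_dae k U F = (\<lambda>r. (total_deriv U ^^ k r) (F r))"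

definition diff_offsets ::
  "('n::finite \<Rightarrow> nat) \<Rightarrow> ('n \<Rightarrow> int) \<times> ('n \<Rightarrow> int) \<Rightarrow> ('n \<Rightarrow> int) \<times> ('n \<Rightarrow> int)" where
  "diff_offsets k = (\<lambda>(c, d).
     let c' = (\<lambda>i. c i - int (k i)); \<gamma> = Min (range c')
     in (\<lambda>i. c' i - \<gamma>, \<lambda>j. d j - \<gamma>))"

end

theory Submission
  imports Defs
begin

text \<open>
  If the highest derivative of \<open>x\<^sub>j\<close> in \<open>g\<close> has order \<open>\<sigma>\<close>, then the total derivative of \<open>g\<close> is
  affine in \<open>x\<^sub>j\<^bsup>(\<sigma>+1)\<^esup>\<close> with leading coefficient \<open>\<partial>g/\<partial>x\<^sub>j\<^bsup>(\<sigma>)\<^esup>\<close>.  Hence differentiating row \<open>i\<close>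
  \<open>k\<^sub>i\<close> times adds \<open>k\<^sub>i\<close> to row \<open>i\<close> of the signature matrix and leaves the leading partial
  derivatives unchanged; the value of every transversal grows by \<open>|k|\<close>, and the offsets of the
  original system shift accordingly.  Along a smooth curve the total derivative is the
  derivative (chain rule), so on an interval \<open>F\<^sub>r\<^bsup>(k\<^sub>r)\<^esup> = 0\<close> together with the vanishing of
  \<open>F\<^sub>r, \<dots>, F\<^sub>r\<^bsup>(k\<^sub>r-1)\<^esup>\<close> at \<open>t\<^sub>0\<close> is equivalent to \<open>F\<^sub>r = 0\<close>.
\<close>

section \<open>The product topology on jet space\<close>

lemma tendsto_fun_iff:
  fixes f :: "'a \<Rightarrow> 'b \<Rightarrow> 'c::topological_space"
  shows "(f \<longlongrightarrow> l) F \<longleftrightarrow> (\<forall>i. ((\<lambda>x. f x i) \<longlongrightarrow> l i) F)"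
  using limitin_componentwise[of "\<lambda>_. euclidean" UNIV f l F]
  by (simp add: euclidean_product_topology)

lemma eventually_fun_upd_in:
  fixes p :: "'b \<Rightarrow> 'c::topological_space"
  assumes "open U" "p \<in> U"
  shows "\<forall>\<^sub>F s in nhds (p v). p(v := s) \<in> U"
proof -
  have "((\<lambda>s. p(v := s)) \<longlongrightarrow> p) (nhds (p v))"
    unfolding tendsto_fun_iff
  proof
    show "((\<lambda>s. (p(v := s)) i) \<longlongrightarrow> p i) (nhds (p v))" for i
      by (cases "i = v") (auto simp: filterlim_ident)
  qed
  with assms show ?thesis
    by (simp add: topological_tendstoD)
qed

text \<open>\<open>occurs\<close> speaks of whole segments inside the domain, so openness of
  \<open>U\<close> is put in the form that short segments in one coordinate direction stay in
  \<open>U\<close>.\<close>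

lemma fun_upd_segment_in:
  fixes p :: "'b \<Rightarrow> real"
  assumes "open U" "p \<in> U"
  obtains \<delta> where "\<delta> > 0"
    "\<And>s r. dist s (p v) < \<delta> \<Longrightarrow> r \<in> closed_segment (p v) s \<Longrightarrow> p(v := r) \<in> U"
proof -
  obtain \<delta> where \<delta>: "\<delta> > 0" "\<And>s. dist s (p v) < \<delta> \<Longrightarrow> p(v := s) \<in> U"
    using eventually_fun_upd_in[OF assms] unfolding eventually_nhds_metric by blast
  have "p(v := r) \<in> U" if "dist s (p v) < \<delta>" "r \<in> closed_segment (p v) s" for s r
    using dist_in_closed_segment(1)[OF that(2)] that(1) by (intro \<delta>(2)) (simp add: dist_commute)
  with \<delta>(1) show ?thesis by (rule that)
qed

section \<open>Partial derivatives and smooth functions\<close>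

text \<open>The values off \<open>U\<close> are arbitrary; openness makes the two slices agree near
  \<open>p v\<close>, which determines the derivative.\<close>

lemma partial_cong:
  assumes "open U" "\<And>q. q \<in> U \<Longrightarrow> f q = g q" "p \<in> U"
  shows "partial v f p = partial v g p"
  unfolding partial_def
  by (intro deriv_cong_ev eventually_mono[OF eventually_fun_upd_in[OF assms(1,3)]]) (auto simp: assms(2))

lemma upd_differentiable_cong:
  fixes f g :: "'n jet \<Rightarrow> real"
  assumes "open U" "\<And>q. q \<in> U \<Longrightarrow> f q = g q" "p \<in> U"
    and "(\<lambda>s. f (p(v := s))) differentiable (at (p v))"
  shows "(\<lambda>s. g (p(v := s))) differentiable (at (p v))"
proof -
  obtain D where "((\<lambda>s. f (p(v := s))) has_real_derivative D) (at (p v))"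
    using assms(4) real_differentiable_def by blast
  moreover have "\<forall>\<^sub>F s in nhds (p v). f (p(v := s)) = g (p(v := s))"
    by (rule eventually_mono[OF eventually_fun_upd_in[OF assms(1,3)]]) (auto simp: assms(2))
  ultimately show ?thesis
    using DERIV_cong_ev[OF refl _ refl, of "\<lambda>s. f (p(v := s))" "\<lambda>s. g (p(v := s))"]
    by (auto simp: real_differentiable_def)
qed

text \<open>Since \<open>foldr partial (vs @ [v]) g\<close> is
  \<open>foldr partial vs (partial v g)\<close>, peeling off the last list entry removes the
  innermost derivative. This turns the definition by lists into a one-step unfolding.\<close>

lemma smooth_fun_iff:
  "smooth_fun U g \<longleftrightarrow> continuous_on U g \<and>
     (\<forall>v. \<forall>p\<in>U. (\<lambda>s. g (p(v := s))) differentiable (at (p v))) \<and>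
     (\<forall>v. smooth_fun U (partial v g))"
proof
  assume L: "smooth_fun U g"
  have "smooth_fun U (partial v g)" for v
    unfolding smooth_fun_def
  proof
    fix vs
    show "continuous_on U (foldr partial vs (partial v g)) \<and>
        (\<forall>w. \<forall>p\<in>U. (\<lambda>s. foldr partial vs (partial v g) (p(w := s))) differentiable (at (p w)))"
      using L[unfolded smooth_fun_def, rule_format, of "vs @ [v]"] by simp
  qed
  then show "continuous_on U g \<and>
     (\<forall>v. \<forall>p\<in>U. (\<lambda>s. g (p(v := s))) differentiable (at (p v))) \<and>
     (\<forall>v. smooth_fun U (partial v g))"
    using L[unfolded smooth_fun_def, rule_format, of "[]"] by simp
next
  assume R: "continuous_on U g \<and>
     (\<forall>v. \<forall>p\<in>U. (\<lambda>s. g (p(v := s))) differentiable (at (p v))) \<and>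
     (\<forall>v. smooth_fun U (partial v g))"
  show "smooth_fun U g"
    unfolding smooth_fun_def
  proof
    fix vs :: "'a jvar list"
    show "continuous_on U (foldr partial vs g) \<and>
        (\<forall>w. \<forall>p\<in>U. (\<lambda>s. foldr partial vs g (p(w := s))) differentiable (at (p w)))"
    proof (cases vs rule: rev_cases)
      case Nil
      then show ?thesis using R by simp
    next
      case (snoc us v)
      have "smooth_fun U (partial v g)" using R by blast
      then show ?thesis unfolding smooth_fun_def snoc by simp
    qed
  qed
qed

lemma smooth_fun_partial: "smooth_fun U g \<Longrightarrow> smooth_fun U (partial v g)"
  by (subst (asm) smooth_fun_iff) blast

lemma smooth_fun_continuous_on: "smooth_fun U g \<Longrightarrow> continuous_on U g"
  by (subst (asm) smooth_fun_iff) blast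

lemma smooth_fun_has_partial:
  assumes "smooth_fun U g" "p \<in> U"
  shows "((\<lambda>s. g (p(v := s))) has_real_derivative partial v g p) (at (p v))"
proof -
  have "(\<lambda>s. g (p(v := s))) differentiable (at (p v))"
    using assms smooth_fun_iff by blast
  then show ?thesis
    unfolding partial_def using DERIV_imp_deriv real_differentiable_def by blast
qed

lemma smooth_fun_has_partial':
  assumes "smooth_fun U g" "p(v := r) \<in> U"
  shows "((\<lambda>s. g (p(v := s))) has_real_derivative partial v g (p(v := r))) (at r)"
  using smooth_fun_has_partial[OF assms, of v] by simp

text \<open>By induction on \<open>vs\<close>, every iterated partial of \<open>g\<close> agrees on
  \<open>U\<close> with some member of \<open>P\<close>, and continuity and differentiability carry
  over from that member.\<close>

lemma smooth_fun_coinduct: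
  assumes U: "open U" and "P g"
    and cont: "\<And>g. P g \<Longrightarrow> continuous_on U g"
    and diff: "\<And>g v p. P g \<Longrightarrow> p \<in> U \<Longrightarrow> (\<lambda>s. g (p(v := s))) differentiable (at (p v))"
    and step: "\<And>g v. P g \<Longrightarrow> \<exists>h. P h \<and> (\<forall>p\<in>U. partial v g p = h p)"
  shows "smooth_fun U g"
proof -
  have eq: "\<exists>h. P h \<and> (\<forall>p\<in>U. foldr partial vs g p = h p)" for vs
  proof (induction vs)
    case Nil
    then show ?case using \<open>P g\<close> by auto
  next
    case (Cons v vs)
    then obtain h where h: "P h" "\<forall>p\<in>U. foldr partial vs g p = h p" by blast
    obtain h' where h': "P h'" "\<forall>p\<in>U. partial v h p = h' p"
      using step[OF h(1)] by blast
    have "foldr partial (v # vs) g p = h' p" if "p \<in> U" for p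
      using partial_cong[OF U, of "foldr partial vs g" h p v] h(2) h'(2) that by simp
    then show ?case using h' by blast
  qed
  show ?thesis
    unfolding smooth_fun_def
  proof
    fix vs
    obtain h where h: "P h" "\<forall>p\<in>U. foldr partial vs g p = h p" using eq by blast
    show "continuous_on U (foldr partial vs g) \<and>
        (\<forall>v. \<forall>p\<in>U. (\<lambda>s. foldr partial vs g (p(v := s))) differentiable (at (p v)))"
    proof (intro conjI allI ballI)
      show "continuous_on U (foldr partial vs g)"
        using cont[OF h(1)] h(2) continuous_on_cong by fastforce
      show "(\<lambda>s. foldr partial vs g (p(v := s))) differentiable (at (p v))" if "p \<in> U" for v p
        using upd_differentiable_cong[OF U _ that diff[OF h(1) that, of v], of "foldr partial vs g"] h(2)
        by simp
    qed
  qed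
qed

text \<open>
  The inductive closure makes the Leibniz rule stay inside the class of functions considered,
  so that coinduction applies.
\<close>

inductive jet_poly :: "'n jet set \<Rightarrow> ('n jet \<Rightarrow> real) \<Rightarrow> bool" for U where
  smooth: "smooth_fun U g \<Longrightarrow> jet_poly U g"
| const: "jet_poly U (\<lambda>_. a)"
| coord: "jet_poly U (\<lambda>p. p v)"
| add: "jet_poly U f \<Longrightarrow> jet_poly U g \<Longrightarrow> jet_poly U (\<lambda>p. f p + g p)"
| mult: "jet_poly U f \<Longrightarrow> jet_poly U g \<Longrightarrow> jet_poly U (\<lambda>p. f p * g p)"

text \<open>Partials of coordinates are the constants 0 and 1, those of sums and products are again
  sums and products, and smooth functions have smooth partials; so the class satisfies the
  conditions of \<open>smooth_fun_coinduct\<close>.\<close>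

lemma jet_poly_smooth:
  assumes U: "open U" and "jet_poly U g"
  shows "smooth_fun U g"
proof (rule smooth_fun_coinduct[where P="jet_poly U", OF assms])
  show "continuous_on U g" if "jet_poly U g" for g
    using that
  proof induction
    case (coord v)
    show ?case by (rule continuous_on_subset[OF continuous_on_product_coordinates]) simp
  qed (auto intro: continuous_intros smooth_fun_continuous_on)
  show diff: "(\<lambda>s. g (p(v := s))) differentiable (at (p v))" if "jet_poly U g" "p \<in> U" for g v p
    using that
  proof induction
    case (smooth g)
    then show ?case using smooth_fun_iff by blast
  next
    case (coord w)
    show ?case by (cases "w = v") auto
  qed auto
  show "\<exists>h. jet_poly U h \<and> (\<forall>p\<in>U. partial v g p = h p)" if "jet_poly U g" for g v
    using that
  proof induction
    case (smooth g)
    then show ?case using smooth_fun_partial jet_poly.smooth by blast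
  next
    case (const a)
    show ?case by (intro exI[of _ "\<lambda>_. 0"]) (auto simp: partial_def intro: jet_poly.const)
  next
    case (coord w)
    show ?case
      by (intro exI[of _ "\<lambda>_. if w = v then 1 else 0"]) (auto simp: partial_def intro: jet_poly.const)
  next
    case (add f g)
    then obtain f' g' where "jet_poly U f'" "\<forall>p\<in>U. partial v f p = f' p"
      "jet_poly U g'" "\<forall>p\<in>U. partial v g p = g' p" by blast
    moreover have "partial v (\<lambda>p. f p + g p) p = partial v f p + partial v g p" if "p \<in> U" for p
      unfolding partial_def
      using diff[OF add.hyps(1) that, of v] diff[OF add.hyps(2) that, of v]
      by (auto simp: field_differentiable_def real_differentiable_def intro!: deriv_add)
    ultimately show ?case
      by (intro exI[of _ "\<lambda>p. f' p + g' p"]) (auto intro: jet_poly.add)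
  next
    case (mult f g)
    then obtain f' g' where "jet_poly U f'" "\<forall>p\<in>U. partial v f p = f' p"
      "jet_poly U g'" "\<forall>p\<in>U. partial v g p = g' p" by blast
    moreover have "partial v (\<lambda>p. f p * g p) p = f p * partial v g p + partial v f p * g p" if "p \<in> U" for p
      unfolding partial_def
      using diff[OF mult.hyps(1) that, of v] diff[OF mult.hyps(2) that, of v]
      by (subst deriv_mult) (auto simp: field_differentiable_def real_differentiable_def)
    ultimately show ?case
      using mult.hyps
      by (intro exI[of _ "\<lambda>p. f p * g' p + f' p * g p"]) (auto intro: jet_poly.add jet_poly.mult)
  qed
qed

lemma jet_poly_sum:
  "(\<And>a. a \<in> A \<Longrightarrow> jet_poly U (f a)) \<Longrightarrow> jet_poly U (\<lambda>p. \<Sum>a\<in>A. f a p)"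
  by (induction A rule: infinite_finite_induct) (auto intro: jet_poly.intros)

lemma smooth_fun_total_deriv:
  assumes "open U" "smooth_fun U g"
  shows "smooth_fun U (total_deriv U g)"
proof (rule jet_poly_smooth[OF assms(1)])
  show "jet_poly U (total_deriv U g)"
    unfolding total_deriv_def case_prod_beta
    by (intro jet_poly.add jet_poly_sum jet_poly.mult jet_poly.coord jet_poly.smooth
        smooth_fun_partial assms(2))
qed

section \<open>Occurring variables\<close>

lemma not_occursD:
  assumes "\<not> occurs U g v" "\<And>r. r \<in> closed_segment (p v) s \<Longrightarrow> p(v := r) \<in> U"
  shows "g (p(v := s)) = g p"
  using assms unfolding occurs_def by blast

lemma not_occursI:
  assumes "\<And>p s. p \<in> U \<Longrightarrow> (\<And>r. r \<in> closed_segment (p v) s \<Longrightarrow> p(v := r) \<in> U) \<Longrightarrow> g (p(v := s)) = g p"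
  shows "\<not> occurs U g v"
  unfolding occurs_def using assms by (metis ends_in_segment(1) fun_upd_triv)

text \<open>Short segments around \<open>p v\<close> stay in \<open>U\<close>, so the slice of
  \<open>g\<close> is locally constant there.\<close>

lemma partial_not_occurs_eq_0:
  assumes U: "open U" and no: "\<not> occurs U g v" and p: "p \<in> U"
  shows "partial v g p = 0"
proof -
  obtain \<delta> where "\<delta> > 0"
    "\<And>s r. dist s (p v) < \<delta> \<Longrightarrow> r \<in> closed_segment (p v) s \<Longrightarrow> p(v := r) \<in> U"
    using fun_upd_segment_in[OF U p] by metis
  then have "\<forall>\<^sub>F s in nhds (p v). g (p(v := s)) = g p"
    unfolding eventually_nhds_metric using not_occursD[OF no] by blast
  then have "deriv (\<lambda>s. g (p(v := s))) (p v) = deriv (\<lambda>s. g p) (p v)"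
    by (rule deriv_cong_ev) simp
  then show ?thesis unfolding partial_def by simp
qed

text \<open>For \<open>v = w\<close> both values are zero. Otherwise the slices of \<open>g\<close>
  in direction \<open>v\<close>, taken at the two values of \<open>w\<close>, coincide near
  \<open>p v\<close> and so have the same derivative.\<close>

lemma not_occurs_partial:
  assumes U: "open U" and no: "\<not> occurs U g w"
  shows "\<not> occurs U (partial v g) w"
proof (rule not_occursI)
  fix p s assume p: "p \<in> U" and seg: "\<And>r. r \<in> closed_segment (p w) s \<Longrightarrow> p(w := r) \<in> U"
  show "partial v g (p(w := s)) = partial v g p"
  proof (cases "v = w")
    case True
    then show ?thesis
      using partial_not_occurs_eq_0[OF U no p] partial_not_occurs_eq_0[OF U no seg[of s]] by simp
  next
    case False
    let ?m = "\<lambda>x::real \<times> real. p(v := fst x, w := snd x)"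
    have "continuous_on UNIV ?m"
    proof (rule continuous_on_coordinatewise_then_product)
      show "continuous_on UNIV (\<lambda>x. ?m x i)" for i
        by (cases "i = w"; cases "i = v") (auto intro: continuous_intros)
    qed
    then have "open (?m -` U)" using U by (simp add: open_vimage)
    moreover have "{p v} \<times> closed_segment (p w) s \<subseteq> ?m -` U"
      using seg by (auto simp: fun_upd_idem)
    \<comment> \<open>The segment is compact, so by the tube lemma its translates stay in
      \<open>U\<close> for all values of \<open>v\<close> in one common neighbourhood of
      \<open>p v\<close>.\<close>
    ultimately obtain X where X: "p v \<in> X" "open X" "X \<times> closed_segment (p w) s \<subseteq> ?m -` U"
      using Elementary_Topology.tube_lemma[OF compact_segment, of "?m -` U" "p v" "p w" s] by blast
    have "g (p(w := s, v := h)) = g (p(v := h))" if "h \<in> X" for h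
    proof -
      have "g ((p(v := h))(w := s)) = g (p(v := h))"
      proof (rule not_occursD[OF no])
        fix r assume "r \<in> closed_segment ((p(v := h)) w) s"
        then show "(p(v := h))(w := r) \<in> U" using X(3) that False by auto
      qed
      then show ?thesis using False by (simp add: fun_upd_twist)
    qed
    then have "\<forall>\<^sub>F h in nhds (p v). g (p(w := s, v := h)) = g (p(v := h))"
      using X(1,2) eventually_nhds by blast
    then show ?thesis
      unfolding partial_def using False by (intro deriv_cong_ev) auto
  qed
qed

text \<open>If the partial vanished along the whole segment that witnesses the occurrence,
  \<open>g\<close> would be constant on it. This relies on \<open>occurs\<close> asking for a
  segment within the domain.\<close>

lemma occurs_imp_partial_neq_0:
  assumes "smooth_fun U g" "occurs U g v"
  obtains p where "p \<in> U" "partial v g p \<noteq> 0"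
proof -
  obtain p s where seg: "\<And>r. r \<in> closed_segment (p v) s \<Longrightarrow> p(v := r) \<in> U"
    and ne: "g (p(v := s)) \<noteq> g p"
    using assms(2) unfolding occurs_def by blast
  have "\<exists>r\<in>closed_segment (p v) s. partial v g (p(v := r)) \<noteq> 0"
  proof (rule ccontr)
    assume "\<not> ?thesis"
    then have "\<exists>c. \<forall>x\<in>closed_segment (p v) s. g (p(v := x)) = c"
      using smooth_fun_has_partial'[OF assms(1) seg]
      by (intro has_field_derivative_zero_constant)
        (auto simp: convex_closed_segment intro: has_field_derivative_at_within)
    then have "g (p(v := s)) = g (p(v := p v))" by (metis ends_in_segment)
    then show False using ne by simp
  qed
  then show ?thesis using seg that by blast
qed

text \<open>The total derivative can involve \<open>w\<close> only through partials of
  \<open>g\<close> or as a factor x_j^(e+1) accompanying an occurring x_j^(e); the two hypotheses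
  exclude both.\<close>

lemma not_occurs_total_deriv:
  assumes U: "open U" and no: "\<not> occurs U g w"
    and pred: "\<And>j e. w = Der j (Suc e) \<Longrightarrow> \<not> occurs U g (Der j e)"
  shows "\<not> occurs U (total_deriv U g) w"
proof (rule not_occursI)
  fix p s assume "p \<in> U" and seg: "\<And>r. r \<in> closed_segment (p w) s \<Longrightarrow> p(w := r) \<in> U"
  have "partial v g (p(w := s)) = partial v g p" for v
    by (rule not_occursD[OF not_occurs_partial[OF U no] seg])
  moreover have "(p(w := s)) (Der j (Suc e)) = p (Der j (Suc e))" if "occurs U g (Der j e)" for j e
    using pred that by auto
  ultimately show "total_deriv U g (p(w := s)) = total_deriv U g p"
    unfolding total_deriv_def
    by (intro arg_cong2[where f="(+)"] sum.cong) auto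
qed

text \<open>The order bound also bounds the occurring derivatives: moving a derivative of order
  above \<open>m\<close> cannot change \<open>g\<close>.\<close>

lemma finite_orderE:
  assumes "finite_order U g"
  obtains m where
    "\<And>p q. p Tm = q Tm \<Longrightarrow> (\<And>j e. e \<le> m \<Longrightarrow> p (Der j e) = q (Der j e)) \<Longrightarrow> p \<in> U \<longleftrightarrow> q \<in> U"
    "\<And>p q. p Tm = q Tm \<Longrightarrow> (\<And>j e. e \<le> m \<Longrightarrow> p (Der j e) = q (Der j e)) \<Longrightarrow> p \<in> U \<Longrightarrow> g p = g q"
    "\<And>j e. occurs U g (Der j e) \<Longrightarrow> e \<le> m"
proof -
  obtain m where m: "\<And>p q. p Tm = q Tm \<Longrightarrow> (\<forall>j. \<forall>e\<le>m. p (Der j e) = q (Der j e)) \<Longrightarrow>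
      (p \<in> U \<longleftrightarrow> q \<in> U) \<and> (p \<in> U \<longrightarrow> g p = g q)"
    using assms unfolding finite_order_def by blast
  have "e \<le> m" if "occurs U g (Der j e)" for j e
  proof (rule ccontr)
    assume "\<not> e \<le> m"
    then have "g (p(Der j e := s)) = g p" if "p \<in> U" for p s
      using m[of p "p(Der j e := s)"] that by auto
    then have "\<not> occurs U g (Der j e)"
      by (intro not_occursI)
    then show False using that by blast
  qed
  with m show ?thesis by (intro that[of m]) blast+
qed

lemma finite_occurs:
  fixes g :: "'n::finite jet \<Rightarrow> real"
  assumes "finite_order U g"
  shows "finite {(j, e). occurs U g (Der j e)}"
proof -
  obtain m where "\<And>j e. occurs U g (Der j e) \<Longrightarrow> e \<le> m"
    using finite_orderE[OF assms] by metis
  then have "{(j, e). occurs U g (Der j e)} \<subseteq> UNIV \<times> {..m}" by auto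
  then show ?thesis by (rule finite_subset) simp
qed

lemma jet_fun_total_deriv:
  assumes "jet_fun U g"
  shows "jet_fun U (total_deriv U g)"
proof -
  have U: "open U" and fo: "finite_order U g" and sm: "smooth_fun U g"
    using assms unfolding jet_fun_def by auto
  obtain m where
    mU: "\<And>p q. p Tm = q Tm \<Longrightarrow> (\<And>j e. e \<le> m \<Longrightarrow> p (Der j e) = q (Der j e)) \<Longrightarrow> p \<in> U \<longleftrightarrow> q \<in> U" and
    mg: "\<And>p q. p Tm = q Tm \<Longrightarrow> (\<And>j e. e \<le> m \<Longrightarrow> p (Der j e) = q (Der j e)) \<Longrightarrow> p \<in> U \<Longrightarrow> g p = g q" and
    mo: "\<And>j e. occurs U g (Der j e) \<Longrightarrow> e \<le> m"
    using fo by (rule finite_orderE) blast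
  \<comment> \<open>The bound rises from \<open>m\<close> to \<open>Suc m\<close> because an
    occurring x_j^(m) brings in the factor x_j^(m+1).\<close>
  have "(p \<in> U \<longleftrightarrow> q \<in> U) \<and> (p \<in> U \<longrightarrow> total_deriv U g p = total_deriv U g q)"
    if Tm: "p Tm = q Tm" and Der: "\<forall>j. \<forall>e\<le>Suc m. p (Der j e) = q (Der j e)" for p q
  proof (intro conjI impI)
    show "p \<in> U \<longleftrightarrow> q \<in> U" using Tm Der by (intro mU) auto
    assume p: "p \<in> U"
    have par: "partial v g p = partial v g q" if "p v = q v" for v
      unfolding partial_def
    proof (rule deriv_cong_ev)
      show "\<forall>\<^sub>F s in nhds (p v). g (p(v := s)) = g (q(v := s))"
        using eventually_fun_upd_in[OF U p]
        by (rule eventually_mono) (intro mg, use Tm Der in auto)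
    qed (use that in simp)
    have le: "e \<le> Suc m" "Suc e \<le> Suc m" if "occurs U g (Der j e)" for j e
      using mo[OF that] by auto
    show "total_deriv U g p = total_deriv U g q"
      unfolding total_deriv_def
      by (intro arg_cong2[where f="(+)"] sum.cong refl par Tm)
        (auto intro!: par arg_cong2[where f="(*)"] Der[rule_format] dest: le)
  qed
  then have "finite_order U (total_deriv U g)"
    unfolding finite_order_def by (intro exI[of _ "Suc m"]) blast
  then show ?thesis
    unfolding jet_fun_def using U smooth_fun_total_deriv[OF U sm] by blast
qed

lemma jet_fun_funpow_total_deriv:
  "jet_fun U g \<Longrightarrow> jet_fun U ((total_deriv U ^^ k) g)"
  by (induction k) (auto intro: jet_fun_total_deriv)

section \<open>Total derivatives raise the leading order by one\<close>

text \<open>Moving x_j^(e+1), which does not occur in \<open>g\<close>, changes no partial of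
  \<open>g\<close>, so only the summand with index \<open>(j, e)\<close> varies. If that index is
  absent from the sum, its partial is zero and the formula still holds.\<close>

lemma total_deriv_upd:
  fixes g :: "'n::finite jet \<Rightarrow> real"
  assumes jf: "jet_fun U g"
    and no: "\<not> occurs U g (Der j (Suc e))"
    and seg: "\<And>r. r \<in> closed_segment (p (Der j (Suc e))) s \<Longrightarrow> p(Der j (Suc e) := r) \<in> U"
  shows "total_deriv U g (p(Der j (Suc e) := s)) =
    total_deriv U g p + partial (Der j e) g p * (s - p (Der j (Suc e)))"
proof -
  have U: "open U" and fin: "finite {(j, e). occurs U g (Der j e)}"
    using jf finite_occurs unfolding jet_fun_def by auto
  let ?w = "Der j (Suc e)" and ?A = "{(j, e). occurs U g (Der j e)}"
  have p: "p \<in> U" using seg[of "p ?w"] by simp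
  have par: "partial v g (p(?w := s)) = partial v g p" for v
    by (rule not_occursD[OF not_occurs_partial[OF U no] seg])
  have "(\<Sum>(j', e')\<in>?A. partial (Der j' e') g p * ((p(?w := s)) (Der j' (Suc e')) - p (Der j' (Suc e'))))
      = (\<Sum>x\<in>?A. if x = (j, e) then partial (Der j e) g p * (s - p ?w) else 0)"
    by (rule sum.cong) (auto split: if_splits)
  also have "\<dots> = partial (Der j e) g p * (s - p ?w)"
    using fin partial_not_occurs_eq_0[OF U _ p, of g "Der j e"] by (simp add: sum.delta)
  finally show ?thesis
    unfolding total_deriv_def par by (simp add: sum_subtractf algebra_simps case_prod_beta)
qed

text \<open>For the converse direction, pick a point where the partial of \<open>g\<close> by
  x_j^(e) is nonzero: there the total derivative is affine in x_j^(e+1) with nonzero slope.\<close>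

lemma occurs_total_deriv_iff:
  fixes g :: "'n::finite jet \<Rightarrow> real"
  assumes jf: "jet_fun U g" and no: "\<not> occurs U g (Der j (Suc e))"
  shows "occurs U (total_deriv U g) (Der j (Suc e)) \<longleftrightarrow> occurs U g (Der j e)"
proof
  have U: "open U" and sm: "smooth_fun U g"
    using jf unfolding jet_fun_def by auto
  show "occurs U g (Der j e)" if "occurs U (total_deriv U g) (Der j (Suc e))"
    using not_occurs_total_deriv[OF U no] that by auto
  assume "occurs U g (Der j e)"
  then obtain p where p: "p \<in> U" "partial (Der j e) g p \<noteq> 0"
    using occurs_imp_partial_neq_0[OF sm] by blast
  let ?w = "Der j (Suc e)"
  obtain \<delta> where \<delta>: "\<delta> > 0"
    "\<And>s r. dist s (p ?w) < \<delta> \<Longrightarrow> r \<in> closed_segment (p ?w) s \<Longrightarrow> p(?w := r) \<in> U"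
    using fun_upd_segment_in[OF U p(1)] by metis
  \<comment> \<open>Half of \<open>\<delta>\<close> gives a nonzero move whose segment lies in the
    ball.\<close>
  define s where "s = p ?w + \<delta> / 2"
  have seg: "p(?w := r) \<in> U" if "r \<in> closed_segment (p ?w) s" for r
    using \<delta>(1) that by (intro \<delta>(2)[of s]) (auto simp: s_def dist_real_def)
  have "total_deriv U g (p(?w := s)) \<noteq> total_deriv U g p"
    using total_deriv_upd[OF jf no seg] p(2) \<delta>(1) by (simp add: s_def)
  then show "occurs U (total_deriv U g) ?w"
    unfolding occurs_def using seg by blast
qed

text \<open>Locally the total derivative is affine in x_j^(e+1), and its derivative is the
  slope.\<close>

lemma partial_total_deriv_top:
  fixes g :: "'n::finite jet \<Rightarrow> real"
  assumes jf: "jet_fun U g" and no: "\<not> occurs U g (Der j (Suc e))" and p: "p \<in> U"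
  shows "partial (Der j (Suc e)) (total_deriv U g) p = partial (Der j e) g p"
proof -
  have U: "open U" using jf unfolding jet_fun_def by auto
  let ?w = "Der j (Suc e)"
  obtain \<delta> where \<delta>: "\<delta> > 0"
    "\<And>s r. dist s (p ?w) < \<delta> \<Longrightarrow> r \<in> closed_segment (p ?w) s \<Longrightarrow> p(?w := r) \<in> U"
    using fun_upd_segment_in[OF U p] by metis
  have "total_deriv U g (p(?w := s)) =
      total_deriv U g p + partial (Der j e) g p * (s - p ?w)" if "dist s (p ?w) < \<delta>" for s
    by (rule total_deriv_upd[OF jf no \<delta>(2)[OF that]])
  then have ev: "\<forall>\<^sub>F s in nhds (p ?w). total_deriv U g (p(?w := s)) =
      total_deriv U g p + partial (Der j e) g p * (s - p ?w)"
    unfolding eventually_nhds_metric using \<delta>(1) by blast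
  have "((\<lambda>s. total_deriv U g p + partial (Der j e) g p * (s - p ?w))
      has_real_derivative partial (Der j e) g p) (at (p ?w))"
    by (auto intro!: derivative_eq_intros)
  then show ?thesis
    unfolding partial_def[of ?w] deriv_cong_ev[OF ev refl] by (rule DERIV_imp_deriv)
qed

section \<open>Leading orders and the signature matrix under repeated differentiation\<close>

lemma top_order_eqI:
  assumes "occurs U g (Der j m)" "\<And>e. e > m \<Longrightarrow> \<not> occurs U g (Der j e)"
  shows "top_order U g j = m"
proof -
  have le: "e \<le> m" if "e \<in> {e. occurs U g (Der j e)}" for e
    using that assms(2) by (meson mem_Collect_eq not_le)
  then have "finite {e. occurs U g (Der j e)}" by (meson finite_nat_set_iff_bounded_le)
  then show ?thesis unfolding top_order_def using assms(1) le by (intro Max_eqI) auto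
qed

text \<open>Finite order makes the set under \<open>Max\<close> finite, so the maximum is
  attained.\<close>

lemma top_order_occurs:
  assumes "finite_order U g" "occurs U g (Der j e)"
  shows "occurs U g (Der j (top_order U g j))"
    and "\<And>e. e > top_order U g j \<Longrightarrow> \<not> occurs U g (Der j e)"
proof -
  let ?E = "{e. occurs U g (Der j e)}"
  obtain m where "\<And>j e. occurs U g (Der j e) \<Longrightarrow> e \<le> m"
    using assms(1) by (rule finite_orderE) blast
  then have fin: "finite ?E" by (metis finite_nat_set_iff_bounded_le mem_Collect_eq)
  show "occurs U g (Der j (top_order U g j))"
    using Max_in[OF fin] assms(2) unfolding top_order_def by auto
  show "\<not> occurs U g (Der j e)" if "e > top_order U g j" for e
    using Max_ge[OF fin, of e] that unfolding top_order_def by auto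
qed

text \<open>The three facts go through one induction on \<open>k\<close>: the absence of derivatives
  above order \<open>\<sigma> + k\<close> is what licenses the next one-step
  differentiation.\<close>

lemma top_order_funpow_total_deriv:
  fixes g :: "'n::finite jet \<Rightarrow> real"
  assumes jf: "jet_fun U g" and occ: "occurs U g (Der j e)"
  defines "\<sigma> \<equiv> top_order U g j"
  shows "occurs U ((total_deriv U ^^ k) g) (Der j (\<sigma> + k))"
    and "top_order U ((total_deriv U ^^ k) g) j = \<sigma> + k"
    and "p \<in> U \<Longrightarrow> partial (Der j (\<sigma> + k)) ((total_deriv U ^^ k) g) p = partial (Der j \<sigma>) g p"
proof -
  have U: "open U" and fo: "finite_order U g" using jf unfolding jet_fun_def by auto
  have *: "occurs U ((total_deriv U ^^ k) g) (Der j (\<sigma> + k)) \<and>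
    (\<forall>e>\<sigma> + k. \<not> occurs U ((total_deriv U ^^ k) g) (Der j e)) \<and>
    (\<forall>p\<in>U. partial (Der j (\<sigma> + k)) ((total_deriv U ^^ k) g) p = partial (Der j \<sigma>) g p)"
  proof (induction k)
    case 0
    then show ?case using top_order_occurs[OF fo occ] unfolding \<sigma>_def by simp
  next
    case (Suc k)
    let ?h = "(total_deriv U ^^ k) g"
    have jh: "jet_fun U ?h" by (rule jet_fun_funpow_total_deriv[OF jf])
    have "\<not> occurs U (total_deriv U ?h) (Der j e)" if "e > Suc (\<sigma> + k)" for e
      using Suc that by (intro not_occurs_total_deriv[OF U]) auto
    then show ?case
      using Suc occurs_total_deriv_iff[OF jh, of j "\<sigma> + k"]
        partial_total_deriv_top[OF jh, of j "\<sigma> + k"] by auto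
  qed
  then show "occurs U ((total_deriv U ^^ k) g) (Der j (\<sigma> + k))"
    and "top_order U ((total_deriv U ^^ k) g) j = \<sigma> + k"
    and "p \<in> U \<Longrightarrow> partial (Der j (\<sigma> + k)) ((total_deriv U ^^ k) g) p = partial (Der j \<sigma>) g p"
    by (auto intro: top_order_eqI)
qed

text \<open>Accounts for the entries -\<infinity> of the signature matrix, which stay
  -\<infinity>.\<close>

lemma not_occurs_funpow_total_deriv:
  assumes U: "open U" and no: "\<And>e. \<not> occurs U g (Der j e)"
  shows "\<not> occurs U ((total_deriv U ^^ k) g) (Der j e)"
proof (induction k arbitrary: e)
  case 0
  then show ?case using no by simp
next
  case (Suc k)
  have "\<not> occurs U (total_deriv U ((total_deriv U ^^ k) g)) (Der j e)"
    by (rule not_occurs_total_deriv[OF U]) (auto simp: Suc)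
  then show ?case by simp
qed

lemma occurs_funpow_total_deriv_iff:
  fixes g :: "'n::finite jet \<Rightarrow> real"
  assumes jf: "jet_fun U g"
  shows "(\<exists>e. occurs U ((total_deriv U ^^ k) g) (Der j e)) \<longleftrightarrow> (\<exists>e. occurs U g (Der j e))"
  using top_order_funpow_total_deriv(1)[OF jf] not_occurs_funpow_total_deriv jf
  unfolding jet_fun_def by metis

lemma sig_matrix_diff_dae:
  assumes "dae U F"
  shows "sig_matrix U (diff_dae k U F) i j = sig_matrix U F i j + ereal (real (k i))"
proof -
  have jf: "jet_fun U (F i)" using assms unfolding dae_def by blast
  show ?thesis
  proof (cases "\<exists>e. occurs U (F i) (Der j e)")
    case True
    then obtain e where "occurs U (F i) (Der j e)" by blast
    then show ?thesis
      using True top_order_funpow_total_deriv(2)[OF jf] occurs_funpow_total_deriv_iff[OF jf]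
      unfolding sig_matrix_def diff_dae_def by simp
  next
    case False
    then show ?thesis
      using occurs_funpow_total_deriv_iff[OF jf] unfolding sig_matrix_def diff_dae_def by simp
  qed
qed

section \<open>Solutions\<close>

text \<open>The endpoints come unordered because a curve may pass to either side of its base value,
  or return to it.\<close>

lemma mvt_closed_segment:
  fixes f :: "real \<Rightarrow> real"
  assumes "\<And>x. x \<in> closed_segment a b \<Longrightarrow> (f has_real_derivative f' x) (at x)"
  obtains x where "x \<in> closed_segment a b" "f b - f a = (b - a) * f' x"
proof (cases a b rule: linorder_cases)
  case less
  then obtain z where "a < z" "z < b" "f b - f a = (b - a) * f' z"
    using MVT2[of a b f f'] assms by (auto simp: closed_segment_eq_real_ivl)
  with less show ?thesis
    by (intro that[of z]) (auto simp: closed_segment_eq_real_ivl)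
next
  case equal
  then show ?thesis using that by auto
next
  case greater
  then obtain z where "b < z" "z < a" "f a - f b = (a - b) * f' z"
    using MVT2[of b a f f'] assms by (auto simp: closed_segment_eq_real_ivl)
  with greater show ?thesis
    by (intro that[of z]) (auto simp: closed_segment_eq_real_ivl algebra_simps)
qed

text \<open>
  The variables are switched from their value at \<open>t0\<close> to the curve one at a time; each switch is
  controlled by the mean value theorem in one variable and continuity of the partial derivative.
\<close>

lemma has_derivative_along_curve_on:
  fixes \<gamma> :: "real \<Rightarrow> 'n jet"
  assumes U: "open U" and sm: "smooth_fun U g" and \<gamma>t0: "\<gamma> t0 \<in> U" and fin: "finite V"
    and der: "\<And>v. v \<in> V \<Longrightarrow> ((\<lambda>t. \<gamma> t v) has_real_derivative \<gamma>' v) (at t0)"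
  shows "((\<lambda>t. g (override_on (\<gamma> t0) (\<gamma> t) V)) has_real_derivative
    (\<Sum>v\<in>V. partial v g (\<gamma> t0) * \<gamma>' v)) (at t0)"
  using fin der
proof (induction V rule: finite_induct)
  case empty
  then show ?case by simp
next
  case (insert v V)
  define p where "p = \<gamma> t0"
  have p: "p \<in> U" using \<gamma>t0 by (simp add: p_def)
  define q where "q t = override_on p (\<gamma> t) V" for t
  \<comment> \<open>\<open>h\<close> is the increment caused by switching \<open>v\<close> after all
    of \<open>V\<close>. The function in question is \<open>h t + g (q t)\<close>, and the induction
    hypothesis differentiates the second summand.\<close>
  define h where "h t = g ((q t)(v := \<gamma> t v)) - g (q t)" for t
  have qv: "(q t)(v := p v) = q t" for t
    using insert.hyps by (auto simp: q_def override_on_def)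
  have qt0: "q t0 = p" by (auto simp: q_def p_def override_on_def)
  have upd: "override_on p (\<gamma> t) (insert v V) = (q t)(v := \<gamma> t v)" for t
    by (auto simp: q_def override_on_def)
  have lim: "(\<lambda>t. \<gamma> t w) \<midarrow>t0\<rightarrow> p w" if "w \<in> insert v V" for w
    using DERIV_isCont[OF insert.prems[OF that]] by (simp add: p_def isCont_def)
  have limq: "(\<lambda>t. q t w) \<midarrow>t0\<rightarrow> p w" for w
    using lim[of w] by (cases "w \<in> V") (auto simp: q_def)
  have lim_upd: "((\<lambda>x. (q (f x))(v := r x)) \<longlongrightarrow> p) F"
    if "filterlim f (at t0) F" "(r \<longlongrightarrow> p v) F" for f r and F :: "'z filter"
    unfolding tendsto_fun_iff
  proof
    show "((\<lambda>x. ((q (f x))(v := r x)) w) \<longlongrightarrow> p w) F" for w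
      using that(2) filterlim_compose[OF limq[of w] that(1)] by (cases "w = v") auto
  qed
  have "\<forall>\<^sub>F x in at t0 \<times>\<^sub>F nhds (p v). (q (fst x))(v := snd x) \<in> U"
    by (rule topological_tendstoD[OF lim_upd[OF filterlim_fst filterlim_snd] U p])
  \<comment> \<open>The product filter lets \<open>t\<close> and the value of \<open>v\<close> vary
    independently, so the entire segment needed for the mean value theorem lies in
    \<open>U\<close>.\<close>
  then obtain P Q where P: "eventually P (at t0)" and Q: "eventually Q (nhds (p v))"
    and PQ: "\<And>t r. P t \<Longrightarrow> Q r \<Longrightarrow> (q t)(v := r) \<in> U"
    unfolding eventually_prod_filter by auto
  obtain e where e: "e > 0" "\<And>r. dist r (p v) < e \<Longrightarrow> Q r"
    using Q unfolding eventually_nhds_metric by blast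
  have near: "\<forall>\<^sub>F t in at t0. P t \<and> dist (\<gamma> t v) (p v) < e"
    using P tendstoD[OF lim[of v] e(1)] by (auto intro: eventually_conj)
  have "\<exists>x. x \<in> closed_segment (p v) (\<gamma> t v) \<and>
      h t = (\<gamma> t v - p v) * partial v g ((q t)(v := x))"
    if t: "P t \<and> dist (\<gamma> t v) (p v) < e" for t
  proof -
    have "((\<lambda>s. g ((q t)(v := s))) has_real_derivative partial v g ((q t)(v := x))) (at x)"
      if "x \<in> closed_segment (p v) (\<gamma> t v)" for x
    proof (intro smooth_fun_has_partial'[OF sm] PQ e(2))
      show "P t" using t by blast
      show "dist x (p v) < e"
        using dist_in_closed_segment(1)[OF that] t by (simp add: dist_commute)
    qed
    then obtain x where "x \<in> closed_segment (p v) (\<gamma> t v)"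
      "g ((q t)(v := \<gamma> t v)) - g ((q t)(v := p v)) = (\<gamma> t v - p v) * partial v g ((q t)(v := x))"
      by (rule mvt_closed_segment)
    then show ?thesis by (auto simp: qv h_def)
  qed
  then obtain \<xi> where
    \<xi>: "\<And>t. P t \<and> dist (\<gamma> t v) (p v) < e \<Longrightarrow> \<xi> t \<in> closed_segment (p v) (\<gamma> t v)" and
    h\<xi>: "\<And>t. P t \<and> dist (\<gamma> t v) (p v) < e \<Longrightarrow> h t = (\<gamma> t v - p v) * partial v g ((q t)(v := \<xi> t))"
    by metis
  \<comment> \<open>The intermediate value is no further from \<open>p v\<close> than
    \<open>\<gamma> t v\<close> is, so it has the same limit.\<close>
  have "\<xi> \<midarrow>t0\<rightarrow> p v"
  proof (rule metric_tendsto_imp_tendsto[OF lim[of v]])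
    show "\<forall>\<^sub>F t in at t0. dist (\<xi> t) (p v) \<le> dist (\<gamma> t v) (p v)"
      using near
    proof (rule eventually_mono)
      fix t assume "P t \<and> dist (\<gamma> t v) (p v) < e"
      then show "dist (\<xi> t) (p v) \<le> dist (\<gamma> t v) (p v)"
        using dist_in_closed_segment(1)[OF \<xi>] by (simp add: dist_commute)
    qed
  qed simp
  then have lim\<xi>: "(\<lambda>t. (q t)(v := \<xi> t)) \<midarrow>t0\<rightarrow> p"
    using lim_upd[of "\<lambda>t. t" "at t0" \<xi>] by (simp add: filterlim_ident)
  have "(\<lambda>t. partial v g ((q t)(v := \<xi> t))) \<midarrow>t0\<rightarrow> partial v g p"
    by (rule continuous_on_tendsto_compose[OF smooth_fun_continuous_on[OF smooth_fun_partial[OF sm]]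
          lim\<xi> p topological_tendstoD[OF lim\<xi> U p]])
  moreover have "(\<lambda>t. (\<gamma> t v - p v) / (t - t0)) \<midarrow>t0\<rightarrow> \<gamma>' v"
    using insert.prems[of v] by (simp add: has_field_derivative_iff p_def)
  ultimately have "(\<lambda>t. partial v g ((q t)(v := \<xi> t)) * ((\<gamma> t v - p v) / (t - t0)))
      \<midarrow>t0\<rightarrow> partial v g p * \<gamma>' v"
    by (rule tendsto_mult)
  \<comment> \<open>Here \<open>h t0 = 0\<close>, since at \<open>t0\<close> the switch changes
    nothing.\<close>
  moreover have "\<forall>\<^sub>F t in at t0. partial v g ((q t)(v := \<xi> t)) * ((\<gamma> t v - p v) / (t - t0))
      = (h t - h t0) / (t - t0)"
    using near by (rule eventually_mono) (simp add: h\<xi>, simp add: h_def qt0, simp add: p_def)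
  ultimately have "(\<lambda>t. (h t - h t0) / (t - t0)) \<midarrow>t0\<rightarrow> partial v g p * \<gamma>' v"
    by (rule Lim_transform_eventually)
  then have "(h has_real_derivative partial v g p * \<gamma>' v) (at t0)"
    by (simp add: has_field_derivative_iff)
  moreover have "((\<lambda>t. g (q t)) has_real_derivative (\<Sum>v\<in>V. partial v g p * \<gamma>' v)) (at t0)"
    using insert.IH insert.prems unfolding q_def p_def by simp
  ultimately have "((\<lambda>t. h t + g (q t)) has_real_derivative
      partial v g p * \<gamma>' v + (\<Sum>v\<in>V. partial v g p * \<gamma>' v)) (at t0)"
    by (rule DERIV_add)
  then show ?case
    using insert.hyps unfolding p_def[symmetric] upd by (simp add: h_def del: fun_upd_apply)
qed

text \<open>Finite order reduces the claim to finitely many variables, where the preceding chain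
  rule applies.\<close>

lemma has_derivative_along_curve:
  fixes \<gamma> :: "real \<Rightarrow> 'n::finite jet"
  assumes jf: "jet_fun U g" and \<gamma>t0: "\<gamma> t0 \<in> U"
    and Tm: "((\<lambda>t. \<gamma> t Tm) has_real_derivative 1) (at t0)"
    and Der: "\<And>j e. ((\<lambda>t. \<gamma> t (Der j e)) has_real_derivative \<gamma> t0 (Der j (Suc e))) (at t0)"
  shows "((\<lambda>t. g (\<gamma> t)) has_real_derivative total_deriv U g (\<gamma> t0)) (at t0)"
proof -
  have U: "open U" and fo: "finite_order U g" and sm: "smooth_fun U g"
    using jf unfolding jet_fun_def by auto
  obtain m where
    mU: "\<And>p q. p Tm = q Tm \<Longrightarrow> (\<And>j e. e \<le> m \<Longrightarrow> p (Der j e) = q (Der j e)) \<Longrightarrow> p \<in> U \<longleftrightarrow> q \<in> U" and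
    mg: "\<And>p q. p Tm = q Tm \<Longrightarrow> (\<And>j e. e \<le> m \<Longrightarrow> p (Der j e) = q (Der j e)) \<Longrightarrow> p \<in> U \<Longrightarrow> g p = g q" and
    mo: "\<And>j e. occurs U g (Der j e) \<Longrightarrow> e \<le> m"
    using fo by (rule finite_orderE) blast
  define B where "B = (\<lambda>(j, e). Der j e) ` (UNIV \<times> {..m} :: ('n \<times> nat) set)"
  define \<gamma>' where "\<gamma>' v = (case v of Tm \<Rightarrow> 1 | Der j e \<Rightarrow> \<gamma> t0 (Der j (Suc e)))" for v
  have finB: "finite B" and TmB: "Tm \<notin> B" by (auto simp: B_def)
  \<comment> \<open>Only time and the derivatives up to order \<open>m\<close> follow the curve; the
    others are frozen at \<open>t0\<close>, which affects neither membership in \<open>U\<close> nor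
    the value of \<open>g\<close>.\<close>
  let ?q = "\<lambda>t. override_on (\<gamma> t0) (\<gamma> t) (insert Tm B)"
  have agree: "?q t Tm = \<gamma> t Tm" "e \<le> m \<Longrightarrow> ?q t (Der j e) = \<gamma> t (Der j e)" for t j e
    by (force simp: override_on_def B_def)+
  have der: "((\<lambda>t. \<gamma> t v) has_real_derivative \<gamma>' v) (at t0)" for v
    using Tm Der by (cases v) (auto simp: \<gamma>'_def)
  have D: "((\<lambda>t. g (?q t)) has_real_derivative
      (\<Sum>v\<in>insert Tm B. partial v g (\<gamma> t0) * \<gamma>' v)) (at t0)"
    by (intro has_derivative_along_curve_on[where \<gamma>=\<gamma>, OF U sm \<gamma>t0] der) (simp add: finB)
  have "?q \<midarrow>t0\<rightarrow> \<gamma> t0"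
    unfolding tendsto_fun_iff
  proof
    show "(\<lambda>t. ?q t v) \<midarrow>t0\<rightarrow> \<gamma> t0 v" for v
      using DERIV_isCont[OF der[of v]] by (cases "v \<in> insert Tm B") (auto simp: isCont_def)
  qed
  then have "\<forall>\<^sub>F t in at t0. ?q t \<in> U"
    using topological_tendstoD[OF _ U \<gamma>t0] by blast
  then have "\<forall>\<^sub>F t in at t0. g (?q t) = g (\<gamma> t)"
    by (rule eventually_mono) (intro mg agree)
  moreover have "?q t0 = \<gamma> t0" by (auto simp: override_on_def)
  ultimately have ev: "\<forall>\<^sub>F t in nhds t0. g (?q t) = g (\<gamma> t)"
    by (simp add: eventually_nhds_conv_at)
  \<comment> \<open>Variables in \<open>B\<close> that do not occur have zero partial, which leaves
    the index set of \<open>total_deriv\<close>.\<close>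
  have "(\<Sum>v\<in>B. partial v g (\<gamma> t0) * \<gamma>' v)
      = (\<Sum>v\<in>(\<lambda>(j, e). Der j e) ` {(j, e). occurs U g (Der j e)}. partial v g (\<gamma> t0) * \<gamma>' v)"
    using finB mo partial_not_occurs_eq_0[OF U _ \<gamma>t0, of g]
    by (intro sum.mono_neutral_right) (force simp: B_def image_iff)+
  also have "\<dots> = (\<Sum>(j, e)\<in>{(j, e). occurs U g (Der j e)}.
      partial (Der j e) g (\<gamma> t0) * \<gamma> t0 (Der j (Suc e)))"
    by (subst sum.reindex) (auto simp: inj_on_def \<gamma>'_def case_prod_beta intro!: sum.cong)
  finally have "(\<Sum>v\<in>insert Tm B. partial v g (\<gamma> t0) * \<gamma>' v) = total_deriv U g (\<gamma> t0)"
    using finB TmB by (simp add: total_deriv_def \<gamma>'_def)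
  with D show ?thesis
    using DERIV_cong_ev[OF refl ev refl] by simp
qed

lemma solution_has_derivative:
  assumes "solution U F I x" and "jet_fun U g" and "t \<in> I"
  shows "((\<lambda>t. g (jet_of x t)) has_real_derivative total_deriv U g (jet_of x t)) (at t)"
proof (rule has_derivative_along_curve[OF assms(2)])
  show "jet_of x t \<in> U" using assms unfolding solution_def by blast
  show "((\<lambda>t. jet_of x t Tm) has_real_derivative 1) (at t)"
    by (simp add: jet_of_def)
  show "((\<lambda>t. jet_of x t (Der j e)) has_real_derivative jet_of x t (Der j (Suc e))) (at t)" for j e
  proof -
    have "(deriv ^^ e) (x j) differentiable (at t)"
      using assms unfolding solution_def by blast
    then show ?thesis
      by (auto simp: jet_of_def real_differentiable_def dest: DERIV_imp_deriv)
  qed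
qed

text \<open>
  Since \<open>I\<close> is connected, a function of \<open>t\<close> vanishes on \<open>I\<close> iff its derivative does and it vanishes
  at \<open>t0\<close>.
\<close>

lemma funpow_total_deriv_vanishes_iff:
  assumes sol: "\<And>t. t \<in> I \<Longrightarrow> jet_of x t \<in> U"
      "\<And>t j e. t \<in> I \<Longrightarrow> (deriv ^^ e) (x j) differentiable (at t)"
    and I: "open I" "is_interval I" "t0 \<in> I" and jf: "jet_fun U (g :: 'n::finite jet \<Rightarrow> real)"
  shows "(\<forall>t\<in>I. (total_deriv U ^^ k) g (jet_of x t) = 0) \<and>
      (\<forall>l<k. (total_deriv U ^^ l) g (jet_of x t0) = 0) \<longleftrightarrow> (\<forall>t\<in>I. g (jet_of x t) = 0)"
proof (induction k)
  case 0
  then show ?case by simp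
next
  case (Suc k)
  let ?h = "(total_deriv U ^^ k) g"
  have jh: "jet_fun U ?h" by (rule jet_fun_funpow_total_deriv[OF jf])
  \<comment> \<open>Any smooth curve in \<open>U\<close> solves the zero system, so the chain rule
    for solutions applies although \<open>x\<close> is not assumed to satisfy an equation.\<close>
  have der: "((\<lambda>t. ?h (jet_of x t)) has_real_derivative total_deriv U ?h (jet_of x t)) (at t)"
    if "t \<in> I" for t
    using sol that by (intro solution_has_derivative[where F="\<lambda>_ _. 0" and I=I] jh) (auto simp: solution_def)
  have "(\<forall>t\<in>I. total_deriv U ?h (jet_of x t) = 0) \<and> ?h (jet_of x t0) = 0
      \<longleftrightarrow> (\<forall>t\<in>I. ?h (jet_of x t) = 0)" (is "?A \<and> ?B \<longleftrightarrow> ?C")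
  proof
    assume AB: "?A \<and> ?B"
    have "\<exists>c. \<forall>t\<in>I. ?h (jet_of x t) = c"
      using AB is_interval_convex[OF I(2)] der
      by (intro has_field_derivative_zero_constant) (auto intro: has_field_derivative_at_within)
    then show ?C using AB I(3) by metis
  next
    assume C: ?C
    \<comment> \<open>As \<open>I\<close> is open, the function vanishes near \<open>t\<close>, so
      its derivative there is also 0.\<close>
    have "total_deriv U ?h (jet_of x t) = 0" if "t \<in> I" for t
    proof (rule DERIV_unique[OF der[OF that]])
      have "\<forall>\<^sub>F s in nhds t. ?h (jet_of x s) = 0"
        using I(1) that C eventually_nhds by blast
      then show "((\<lambda>t. ?h (jet_of x t)) has_real_derivative 0) (at t)"
        using DERIV_cong_ev[OF refl _ refl, of "\<lambda>t. ?h (jet_of x t)" "\<lambda>_. 0"] by simp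
    qed
    with C I(3) show "?A \<and> ?B" by blast
  qed
  then show ?case using Suc by (auto simp: less_Suc_eq)
qed

text \<open>Smoothness and membership in \<open>U\<close> are common to both systems; if they fail,
  neither side holds. Otherwise each row is handled on its own.\<close>

lemma solution_diff_dae_iff:
  assumes "dae U F" and "open I" "is_interval I" "t0 \<in> I"
  shows "solution U (diff_dae k U F) I x \<and>
      (\<forall>r. \<forall>l<k r. (total_deriv U ^^ l) (F r) (jet_of x t0) = 0) \<longleftrightarrow> solution U F I x"
proof (cases "\<forall>t\<in>I. (\<forall>j e. (deriv ^^ e) (x j) differentiable (at t)) \<and> jet_of x t \<in> U")
  case True
  then have "(\<forall>t\<in>I. (total_deriv U ^^ k r) (F r) (jet_of x t) = 0) \<and>
      (\<forall>l<k r. (total_deriv U ^^ l) (F r) (jet_of x t0) = 0) \<longleftrightarrow> (\<forall>t\<in>I. F r (jet_of x t) = 0)" for r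
    using assms by (intro funpow_total_deriv_vanishes_iff) (auto simp: dae_def)
  with True show ?thesis unfolding solution_def diff_dae_def by blast
next
  case False
  then show ?thesis unfolding solution_def by blast
qed

section \<open>Transversals and offsets\<close>

text \<open>A transversal meets each row exactly once, so the first projection is a bijection onto
  the rows.\<close>

lemma transversal_sum_fst:
  fixes T :: "('n::finite \<times> 'n) set"
  assumes "transversal T"
  shows "(\<Sum>(i, j)\<in>T. f i) = (\<Sum>i\<in>UNIV. f i)"
proof -
  have "bij_betw fst T UNIV"
    using assms unfolding transversal_def bij_betw_def inj_on_def by (force simp: image_iff)
  then show ?thesis
    by (simp add: case_prod_beta sum.reindex_bij_betw)
qed

text \<open>Ensures that the maximum in \<open>Val\<close> is taken over a nonempty set.\<close>

lemma transversal_Id: "transversal Id"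
  unfolding transversal_def by auto

lemma tvalue_add_rows:
  fixes T :: "('n::finite \<times> 'n) set"
  assumes "transversal T"
  shows "tvalue (\<lambda>i j. S i j + ereal (real (k i))) T = tvalue S T + ereal (real (\<Sum>i\<in>UNIV. k i))"
proof -
  have "tvalue (\<lambda>i j. S i j + ereal (real (k i))) T = tvalue S T + (\<Sum>(i, j)\<in>T. ereal (real (k i)))"
    unfolding tvalue_def by (simp add: sum.distrib case_prod_beta)
  then show ?thesis
    using transversal_sum_fst[OF assms, of "\<lambda>i. ereal (real (k i))"] by simp
qed

text \<open>Every transversal gains the same amount, and this shift is monotone on
  \<open>ereal\<close>, hence commutes with \<open>Max\<close>.\<close>

lemma Val_add_rows:
  fixes S :: "'n::finite \<Rightarrow> 'n \<Rightarrow> ereal"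
  shows "Val (\<lambda>i j. S i j + ereal (real (k i))) = Val S + ereal (real (\<Sum>i\<in>UNIV. k i))"
proof -
  let ?T = "{T :: ('n \<times> 'n) set. transversal T}" and ?a = "ereal (real (\<Sum>i\<in>UNIV. k i))"
  have "tvalue (\<lambda>i j. S i j + ereal (real (k i))) ` ?T = (\<lambda>y. y + ?a) ` tvalue S ` ?T"
    unfolding image_image using tvalue_add_rows by (intro image_cong) auto
  moreover have "Max ((\<lambda>y. y + ?a) ` tvalue S ` ?T) = Max (tvalue S ` ?T) + ?a"
    using transversal_Id
    by (intro mono_Max_commute[symmetric]) (auto intro!: monoI add_right_mono)
  ultimately show ?thesis unfolding Val_def by simp
qed

lemma hvt_add_rows: "hvt (\<lambda>i j. S i j + ereal (real (k i))) T \<longleftrightarrow> hvt S T"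
proof (cases "transversal T")
  case True
  \<comment> \<open>The added amount is finite, so it cancels even where a value is
    infinite.\<close>
  have "a + ereal (real m) = b + ereal (real m) \<longleftrightarrow> a = b" "a + ereal (real m) = -\<infinity> \<longleftrightarrow> a = -\<infinity>"
    for a b m by (cases a; cases b; simp)+
  then show ?thesis
    using True unfolding hvt_def Val_add_rows by (simp add: tvalue_add_rows del: of_nat_sum)
qed (simp add: hvt_def)

section \<open>Offsets and Jacobian of the differentiated system\<close>

lemma ereal_add_le_iff_rows:
  "S + ereal (real m) \<le> ereal (of_int (a + int m)) \<longleftrightarrow> S \<le> ereal (of_int a)"
  "S + ereal (real m) = ereal (of_int (a + int m)) \<longleftrightarrow> S = ereal (of_int a)"
  by (cases S; simp)+

text \<open>The normalising shift \<open>\<gamma>\<close> cancels in d_j - c_i, the only form in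
  which offsets enter validity and the Jacobian.\<close>

lemma diff_offsets_diff:
  assumes "(cs, ds) = diff_offsets k (c, d)"
  shows "ds j - cs i = d j - c i + int (k i)"
  using assms unfolding diff_offsets_def Let_def by auto

text \<open>Both sides of each comparison in row \<open>i\<close> rise by \<open>k i\<close>, so the
  same transversal witnesses equality.\<close>

lemma valid_offsets_diff_offsets:
  assumes "valid_offsets S c d" "(cs, ds) = diff_offsets k (c, d)"
  shows "valid_offsets (\<lambda>i j. S i j + ereal (real (k i))) cs ds"
  using assms(1) unfolding valid_offsets_def diff_offsets_diff[OF assms(2)] ereal_add_le_iff_rows .

lemma normalised_diff_offsets:
  assumes "(cs, ds) = diff_offsets k (c, d)"
  shows "normalised cs"
proof -
  let ?c = "\<lambda>i. c i - int (k i)"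
  have cs: "cs = (\<lambda>i. ?c i - Min (range ?c))"
    using assms unfolding diff_offsets_def Let_def by auto
  have "Min (range cs) = Min ((\<lambda>a. a - Min (range ?c)) ` range ?c)"
    unfolding cs image_image ..
  also have "\<dots> = Min (range ?c) - Min (range ?c)"
    by (intro mono_Min_commute[symmetric]) (auto intro: monoI)
  finally show ?thesis unfolding normalised_def by simp
qed

text \<open>The positions with d_j - c_i = \<sigma>_ij are the same for both systems, and there the
  leading partials coincide.\<close>

lemma system_jacobian_diff_dae:
  assumes "dae U F" "(cs, ds) = diff_offsets k (c, d)" "p \<in> U"
  shows "system_jacobian U (diff_dae k U F) cs ds p = system_jacobian U F c d p"
proof -
  have "partial (Der j (top_order U (diff_dae k U F i) j)) (diff_dae k U F i) p
      = partial (Der j (top_order U (F i) j)) (F i) p"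
    if sig: "sig_matrix U F i j = ereal (of_int (d j - c i))" for i j
  proof -
    have "jet_fun U (F i)" using assms(1) unfolding dae_def by blast
    \<comment> \<open>The entry is finite, so x_j does occur in row \<open>i\<close>.\<close>
    moreover obtain e where "occurs U (F i) (Der j e)"
      using sig unfolding sig_matrix_def by (auto split: if_splits)
    ultimately show ?thesis
      using top_order_funpow_total_deriv(2,3) assms(3) unfolding diff_dae_def by metis
  qed
  then show ?thesis
    unfolding system_jacobian_def vec_eq_iff
    by (auto simp: sig_matrix_diff_dae[OF assms(1)] diff_offsets_diff[OF assms(2)]
        ereal_add_le_iff_rows simp del: of_int_add of_int_diff)
qed

section \<open>Structural amenability and initial conditions of the differentiated system\<close>

lemma dae_diff_dae: "dae U F \<Longrightarrow> dae U (diff_dae k U F)"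
  unfolding dae_def diff_dae_def using jet_fun_funpow_total_deriv by blast

text \<open>A solution of the original system solves the differentiated one, so the same consistent
  point works. It lies in \<open>U\<close>, where the Jacobians agree.\<close>

lemma structurally_amenable_diff_dae:
  assumes "structurally_amenable U F"
  shows "structurally_amenable U (diff_dae k U F)"
proof -
  obtain c d p where dae: "dae U F" and val: "valid_offsets (sig_matrix U F) c d"
    and p: "consistent_point U F p" and inv: "invertible (system_jacobian U F c d p)"
    using assms unfolding structurally_amenable_def by blast
  obtain cs ds where cs: "(cs, ds) = diff_offsets k (c, d)"
    by (metis surj_pair)
  have sig: "sig_matrix U (diff_dae k U F) = (\<lambda>i j. sig_matrix U F i j + ereal (real (k i)))"
    using sig_matrix_diff_dae[OF dae] by blast
  have "p \<in> U" using p unfolding consistent_point_def solution_def by blast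
  moreover have "consistent_point U (diff_dae k U F) p"
    using p solution_diff_dae_iff[OF dae] unfolding consistent_point_def by metis
  ultimately show ?thesis
    unfolding structurally_amenable_def
    using dae_diff_dae[OF dae] valid_offsets_diff_offsets[OF val cs] inv
      system_jacobian_diff_dae[OF dae cs] sig by metis
qed

text \<open>The conditions are the vanishing of F_r^(l) at \<open>t0\<close> for l < k_r. A list is
  used so that its length is exactly |k| even if some of these functions coincide.\<close>

lemma initial_conditions_diff_dae:
  fixes F :: "'n::finite \<Rightarrow> 'n jet \<Rightarrow> real"
  assumes "dae U F"
  obtains gs :: "('n jet \<Rightarrow> real) list" where
    "length gs = (\<Sum>r\<in>UNIV. k r)" "\<forall>g\<in>set gs. jet_fun U g"
    "\<And>t0 I x. open I \<Longrightarrow> is_interval I \<Longrightarrow> t0 \<in> I \<Longrightarrow>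
      solution U (diff_dae k U F) I x \<and> (\<forall>g\<in>set gs. g (jet_of x t0) = 0) \<longleftrightarrow> solution U F I x"
proof -
  \<comment> \<open>Enumerating the rows without repetition turns the length of the concatenation
    into the sum of all \<open>k r\<close>.\<close>
  obtain rs where rs: "set rs = (UNIV :: 'n set)" "distinct rs"
    using finite_distinct_list[OF finite] by metis
  define gs where "gs = concat (map (\<lambda>r. map (\<lambda>l. (total_deriv U ^^ l) (F r)) [0..<k r]) rs)"
  have set_gs: "(\<forall>g\<in>set gs. P g) \<longleftrightarrow> (\<forall>r. \<forall>l<k r. P ((total_deriv U ^^ l) (F r)))" for P
    by (auto simp: gs_def rs(1))
  have "length gs = (\<Sum>r\<in>UNIV. k r)"
    using rs by (simp add: gs_def length_concat comp_def sum_list_distinct_conv_sum_set)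
  moreover have "\<forall>g\<in>set gs. jet_fun U g"
    unfolding set_gs using assms jet_fun_funpow_total_deriv unfolding dae_def by blast
  moreover have "solution U (diff_dae k U F) I x \<and> (\<forall>g\<in>set gs. g (jet_of x t0) = 0) \<longleftrightarrow> solution U F I x"
    if "open I" "is_interval I" "t0 \<in> I" for t0 I x
    unfolding set_gs by (rule solution_diff_dae_iff[OF assms that])
  ultimately show ?thesis by (rule that)
qed

theorem theorem3p5:
  fixes U :: "'n::finite jet set"
    and F Fs :: "'n \<Rightarrow> 'n jet \<Rightarrow> real"
    and c d cs ds :: "'n \<Rightarrow> int"
    and k :: "'n \<Rightarrow> nat"
  assumes "structurally_amenable U F"
    and "valid_offsets (sig_matrix U F) c d"
    and "normalised c"
    and "Fs = diff_dae k U F"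
    and "(cs, ds) = diff_offsets k (c, d)"
  shows
    "{T. hvt (sig_matrix U Fs) T} = {T. hvt (sig_matrix U F) T} \<and>
     (valid_offsets (sig_matrix U Fs) cs ds \<and> normalised cs) \<and>
     (\<forall>p\<in>U. system_jacobian U Fs cs ds p = system_jacobian U F c d p) \<and>
     (structurally_amenable U Fs \<and>
      dof U Fs = dof U F + ereal (real (\<Sum>r\<in>UNIV. k r)) \<and>
      (\<forall>t0. \<exists>gs :: ('n jet \<Rightarrow> real) list.
         length gs = (\<Sum>r\<in>UNIV. k r) \<and> (\<forall>g\<in>set gs. jet_fun U g) \<and>
         (\<forall>I x. open I \<and> is_interval I \<and> t0 \<in> I \<longrightarrow>
            ((solution U Fs I x \<and> (\<forall>g\<in>set gs. g (jet_of x t0) = 0)) \<longleftrightarrow> solution U F I x))))"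
proof -
  have dae: "dae U F" using assms(1) unfolding structurally_amenable_def by blast
  have sig: "sig_matrix U Fs = (\<lambda>i j. sig_matrix U F i j + ereal (real (k i)))"
    using sig_matrix_diff_dae[OF dae] unfolding assms(4) by blast
  \<comment> \<open>One list of conditions serves all base points at once.\<close>
  obtain gs :: "('n jet \<Rightarrow> real) list" where
    "length gs = (\<Sum>r\<in>UNIV. k r)" "\<forall>g\<in>set gs. jet_fun U g"
    "\<And>t0 I x. open I \<Longrightarrow> is_interval I \<Longrightarrow> t0 \<in> I \<Longrightarrow>
      solution U Fs I x \<and> (\<forall>g\<in>set gs. g (jet_of x t0) = 0) \<longleftrightarrow> solution U F I x"
    unfolding assms(4) using initial_conditions_diff_dae[OF dae] by metis
  then have "\<forall>t0. \<exists>gs :: ('n jet \<Rightarrow> real) list.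
         length gs = (\<Sum>r\<in>UNIV. k r) \<and> (\<forall>g\<in>set gs. jet_fun U g) \<and>
         (\<forall>I x. open I \<and> is_interval I \<and> t0 \<in> I \<longrightarrow>
            ((solution U Fs I x \<and> (\<forall>g\<in>set gs. g (jet_of x t0) = 0)) \<longleftrightarrow> solution U F I x))"
    by blast
  moreover have "structurally_amenable U Fs"
    unfolding assms(4) by (rule structurally_amenable_diff_dae[OF assms(1)])
  moreover have "\<forall>p\<in>U. system_jacobian U Fs cs ds p = system_jacobian U F c d p"
    unfolding assms(4) using system_jacobian_diff_dae[OF dae assms(5)] by blast
  ultimately show ?thesis
    using valid_offsets_diff_offsets[OF assms(2,5)] normalised_diff_offsets[OF assms(5)]
    unfolding dof_def sig hvt_add_rows Val_add_rows by blast
qed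

end
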